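(* Let $f:\omega\to\omega$ be a permutation such that the map $\pi$ defined by $\pi([A]_{\mathrm T})=[f^*(A)]_{\mathrm T}$ for $A\in 2^\omega$ is an automorphism of the Turing degrees. Then $f$ is recursive.
   Context: For $f:\omega\to\omega$, the pullback $f^*$ is given by $f^*(A)(n)=A(f(n))$ for $A\in 2^\omega$ (subsets of $\omega$ identified with characteristic functions). An automorphism of the Turing degrees is a bijection of the set of Turing degrees of subsets of $\omega$ preserving and reflecting $\le_{\mathrm T}$; it is induced by $f$ if it is given by $[A]\mapsto[f^*(A)]$. *)

theory Defs
  imports Main
begin

text \<open>
  Kleene's \<open>\<mu>\<close>-recursive functions relative to an oracle function \<open>g :: nat \<Rightarrow> nat\<close>.
  Programs act on lists of arguments of any length; an application with too few arguments,
  or of a unary primitive to the wrong number of arguments, has no value.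
\<close>

datatype recf =
    Zero
  | Succ
  | Proj nat
  | Oracle
  | Comp recf "recf list"
  | PrimRec recf recf
  | Mu recf

text \<open>
  \<open>rec_eval g p xs y\<close> says that \<open>p\<close> with oracle \<open>g\<close> halts on \<open>xs\<close> with
  value \<open>y\<close>. In the rule for \<open>Mu p\<close>, the values of \<open>p\<close> below the zero found must
  all be defined and nonzero.
\<close>

inductive rec_eval :: "(nat \<Rightarrow> nat) \<Rightarrow> recf \<Rightarrow> nat list \<Rightarrow> nat \<Rightarrow> bool" for g where
  rec_eval_Zero: "rec_eval g Zero xs 0"
| rec_eval_Succ: "rec_eval g Succ [x] (Suc x)"
| rec_eval_Proj: "i < length xs \<Longrightarrow> rec_eval g (Proj i) xs (xs ! i)"
| rec_eval_Oracle: "rec_eval g Oracle [x] (g x)"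
| rec_eval_Comp: "list_all2 (\<lambda>q y. rec_eval g q xs y) qs ys \<Longrightarrow> rec_eval g p ys z \<Longrightarrow> rec_eval g (Comp p qs) xs z"
| rec_eval_PrimRec_0: "rec_eval g p xs y \<Longrightarrow> rec_eval g (PrimRec p q) (0 # xs) y"
| rec_eval_PrimRec_Suc: "rec_eval g (PrimRec p q) (n # xs) r \<Longrightarrow> rec_eval g q (n # r # xs) y \<Longrightarrow>
    rec_eval g (PrimRec p q) (Suc n # xs) y"
| rec_eval_Mu: "rec_eval g p (y # xs) 0 \<Longrightarrow> (\<And>z. z < y \<Longrightarrow> \<exists>w. rec_eval g p (z # xs) (Suc w)) \<Longrightarrow>
    rec_eval g (Mu p) xs y"

primrec oracle_free :: "recf \<Rightarrow> bool" where
  "oracle_free Zero \<longleftrightarrow> True"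
| "oracle_free Succ \<longleftrightarrow> True"
| "oracle_free (Proj i) \<longleftrightarrow> True"
| "oracle_free Oracle \<longleftrightarrow> False"
| "oracle_free (Comp p qs) \<longleftrightarrow> oracle_free p \<and> list_all (\<lambda>b. b) (map oracle_free qs)"
| "oracle_free (PrimRec p q) \<longleftrightarrow> oracle_free p \<and> oracle_free q"
| "oracle_free (Mu p) \<longleftrightarrow> oracle_free p"

definition recursive_in :: "(nat \<Rightarrow> nat) \<Rightarrow> (nat \<Rightarrow> nat) \<Rightarrow> bool" where
  "recursive_in g f \<longleftrightarrow> (\<exists>p. \<forall>n. rec_eval g p [n] (f n))"

text \<open>The oracle supplied to an oracle-free program is irrelevant.\<close>

definition recursive :: "(nat \<Rightarrow> nat) \<Rightarrow> bool" where
  "recursive f \<longleftrightarrow> (\<exists>p. oracle_free p \<and> (\<forall>n. rec_eval (\<lambda>_. 0) p [n] (f n)))"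

type_synonym cantor = "nat \<Rightarrow> bool"

definition turing_le :: "cantor \<Rightarrow> cantor \<Rightarrow> bool" (infix "\<le>\<^sub>T" 50) where
  "A \<le>\<^sub>T B \<longleftrightarrow> recursive_in (\<lambda>n. of_bool (B n)) (\<lambda>n. of_bool (A n))"

definition turing_equiv :: "cantor \<Rightarrow> cantor \<Rightarrow> bool" (infix "\<equiv>\<^sub>T" 50) where
  "A \<equiv>\<^sub>T B \<longleftrightarrow> A \<le>\<^sub>T B \<and> B \<le>\<^sub>T A"

primrec subst_oracle :: "recf \<Rightarrow> recf \<Rightarrow> recf" where
  "subst_oracle r Zero = Zero"
| "subst_oracle r Succ = Succ"
| "subst_oracle r (Proj i) = Proj i"
| "subst_oracle r Oracle = r"
| "subst_oracle r (Comp p qs) = Comp (subst_oracle r p) (map (subst_oracle r) qs)"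
| "subst_oracle r (PrimRec p q) = PrimRec (subst_oracle r p) (subst_oracle r q)"
| "subst_oracle r (Mu p) = Mu (subst_oracle r p)"

lemma rec_eval_subst_oracle:
  assumes "\<And>n. rec_eval g r [n] (f n)" and "rec_eval f p xs y"
  shows "rec_eval g (subst_oracle r p) xs y"
  using assms(2)
proof (induction rule: rec_eval.induct)
  case (rec_eval_Comp xs qs ys p z)
  have "list_all2 (\<lambda>q y. rec_eval g q xs y) (map (subst_oracle r) qs) ys"
    using rec_eval_Comp.IH(1) rec_eval_Comp.hyps(1)
    by (auto simp: list_all2_conv_all_nth)
  with rec_eval_Comp.IH show ?case
    by (auto intro: rec_eval.rec_eval_Comp)
next
  case (rec_eval_Mu p y xs)
  then show ?case
    by (auto intro!: rec_eval.rec_eval_Mu)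
qed (auto intro: rec_eval.intros assms(1))

lemma rec_eval_det: "rec_eval g p xs y \<Longrightarrow> rec_eval g p xs y' \<Longrightarrow> y = y'"
proof (induction arbitrary: y' rule: rec_eval.induct)
  case (rec_eval_Comp xs qs ys p z)
  from rec_eval_Comp.prems obtain ys' where
    "list_all2 (\<lambda>q y. rec_eval g q xs y) qs ys'" and z: "rec_eval g p ys' y'"
    by (auto elim: rec_eval.cases)
  with rec_eval_Comp.IH(1) have "ys = ys'"
    by (auto simp: list_all2_conv_all_nth intro!: nth_equalityI)
  with z rec_eval_Comp.IH(2) show ?case by simp
next
  case (rec_eval_Mu p y xs)
  from rec_eval_Mu.prems have y': "rec_eval g p (y' # xs) 0"
    "\<And>z. z < y' \<Longrightarrow> \<exists>w. rec_eval g p (z # xs) (Suc w)"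
    by (auto elim: rec_eval.cases)
  show ?case
  proof (cases y y' rule: linorder_cases)
    case less
    with y'(2) rec_eval_Mu.IH(1) show ?thesis by blast
  next
    case greater
    with y'(1) rec_eval_Mu.IH(2) show ?thesis by blast
  qed
next
  case (rec_eval_PrimRec_0 p xs y q)
  from rec_eval_PrimRec_0.prems have "rec_eval g p xs y'" by (auto elim: rec_eval.cases)
  then show ?case by (rule rec_eval_PrimRec_0.IH)
next
  case (rec_eval_PrimRec_Suc p q n xs r y)
  from rec_eval_PrimRec_Suc.prems obtain r' where
    "rec_eval g (PrimRec p q) (n # xs) r'" "rec_eval g q (n # r' # xs) y'"
    by (auto elim: rec_eval.cases)
  with rec_eval_PrimRec_Suc.IH show ?case by metis
qed (auto elim: rec_eval.cases)

lemma recursive_in_refl: "recursive_in g g"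
  unfolding recursive_in_def using rec_eval_Oracle by blast

lemma recursive_in_trans: "recursive_in g f \<Longrightarrow> recursive_in f h \<Longrightarrow> recursive_in g h"
  unfolding recursive_in_def by (meson rec_eval_subst_oracle)

lemma turing_le_refl: "A \<le>\<^sub>T A"
  unfolding turing_le_def by (rule recursive_in_refl)

lemma turing_le_trans: "A \<le>\<^sub>T B \<Longrightarrow> B \<le>\<^sub>T C \<Longrightarrow> A \<le>\<^sub>T C"
  unfolding turing_le_def by (rule recursive_in_trans)

lemma oracle_free_subst_Zero: "oracle_free (subst_oracle Zero p)"
  by (induction p) (auto simp: list_all_iff)

lemma recursive_iff_recursive_in_zero: "recursive f \<longleftrightarrow> recursive_in (\<lambda>_. 0) f"
proof
  assume "recursive_in (\<lambda>_. 0) f"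
  then obtain p where "\<And>n. rec_eval (\<lambda>_. 0) p [n] (f n)"
    unfolding recursive_in_def by blast
  then have "\<And>n. rec_eval (\<lambda>_. 0) (subst_oracle Zero p) [n] (f n)"
    by (intro rec_eval_subst_oracle[where f = "\<lambda>_. 0"] rec_eval_Zero)
  then show "recursive f"
    unfolding recursive_def using oracle_free_subst_Zero by blast
qed (auto simp: recursive_def recursive_in_def)

quotient_type turing_degree = cantor / turing_equiv
  morphisms rep_turing_degree deg
  by (rule equivpI)
    (auto simp: turing_equiv_def intro!: reflpI sympI transpI intro: turing_le_refl turing_le_trans)

instantiation turing_degree :: order
begin

lift_definition less_eq_turing_degree :: "turing_degree \<Rightarrow> turing_degree \<Rightarrow> bool" is turing_le
  by (auto simp: turing_equiv_def intro: turing_le_trans)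

definition less_turing_degree :: "turing_degree \<Rightarrow> turing_degree \<Rightarrow> bool" where
  "less_turing_degree a b \<longleftrightarrow> a \<le> b \<and> \<not> b \<le> a"

instance
proof
  fix a b c :: turing_degree
  show "a < b \<longleftrightarrow> a \<le> b \<and> \<not> b \<le> a" by (rule less_turing_degree_def)
  show "a \<le> a" by transfer (rule turing_le_refl)
  show "a \<le> b \<Longrightarrow> b \<le> c \<Longrightarrow> a \<le> c" by transfer (rule turing_le_trans)
  show "a \<le> b \<Longrightarrow> b \<le> a \<Longrightarrow> a = b" by transfer (simp add: turing_equiv_def)
qed

end

definition degree_automorphism :: "(turing_degree \<Rightarrow> turing_degree) \<Rightarrow> bool" where
  "degree_automorphism \<pi> \<longleftrightarrow> bij \<pi> \<and> (\<forall>a b. a \<le> b \<longleftrightarrow> \<pi> a \<le> \<pi> b)"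

definition pullback :: "(nat \<Rightarrow> nat) \<Rightarrow> cantor \<Rightarrow> cantor" where
  "pullback f A = (\<lambda>n. A (f n))"

end

theory Submission
  imports Defs "HOL-Library.Countable" "HOL-Library.Discrete_Functions"
begin

text \<open>
  Put \<open>g = f\<^sup>-\<^sup>1 \<circ> Suc \<circ> f\<close>.  Every \<open>B\<close> computes \<open>B \<circ> Suc\<close>, so the induced automorphism, applied to
  \<open>B = A \<circ> f\<^sup>-\<^sup>1\<close>, shows that every \<open>A\<close> computes \<open>A \<circ> g\<close>.  By Baire category one program \<open>p\<close> does this
  for a dense set of \<open>A\<close> in some cylinder.  Then \<open>g\<close> is recursive: if \<open>p\<close> gives different answers at
  \<open>n\<close> for two finite oracles in that cylinder which differ only at the position \<open>k\<close>, density forces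
  \<open>k = g n\<close>, and such a pair can be searched for unless \<open>g n\<close> is one of the finitely many positions
  fixed by the cylinder.  Since \<open>f\<^sup>-\<^sup>1 (m + 1) = g (f\<^sup>-\<^sup>1 m)\<close>, the inverse of \<open>f\<close> is recursive, and so is
  \<open>f\<close>.
\<close>

section \<open>Closure properties of total computable functions\<close>

text \<open>The zero oracle replaces the syntactic condition \<open>oracle_free\<close>; by
  \<open>recursive_iff_recursive_in_zero\<close> the unary functions obtained are the recursive
  ones.\<close>

definition computable :: "nat \<Rightarrow> (nat list \<Rightarrow> nat) \<Rightarrow> bool" where
  "computable k F \<longleftrightarrow> (\<exists>p. \<forall>xs. length xs = k \<longrightarrow> rec_eval (\<lambda>_. 0) p xs (F xs))"

lemma computable_cong:
  "(\<And>xs. length xs = k \<Longrightarrow> F xs = G xs) \<Longrightarrow> computable k F \<longleftrightarrow> computable k G"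
  unfolding computable_def by metis

lemma computable_compose:
  assumes G: "computable (length Fs) G" and Fs: "\<And>F. F \<in> set Fs \<Longrightarrow> computable k F"
  shows "computable k (\<lambda>xs. G (map (\<lambda>F. F xs) Fs))"
proof -
  from G obtain p where p: "\<And>ys. length ys = length Fs \<Longrightarrow> rec_eval (\<lambda>_. 0) p ys (G ys)"
    unfolding computable_def by blast
  from Fs obtain q where q: "\<And>F xs. F \<in> set Fs \<Longrightarrow> length xs = k \<Longrightarrow> rec_eval (\<lambda>_. 0) (q F) xs (F xs)"
    unfolding computable_def by metis
  have "rec_eval (\<lambda>_. 0) (Comp p (map q Fs)) xs (G (map (\<lambda>F. F xs) Fs))" if "length xs = k" for xs
    by (rule rec_eval_Comp[where ys = "map (\<lambda>F. F xs) Fs"])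
      (use that p q in \<open>auto simp: list_all2_conv_all_nth\<close>)
  then show ?thesis
    unfolding computable_def by blast
qed

lemma computable_compose1:
  assumes "computable 1 (\<lambda>xs. h (xs ! 0))" "computable k F"
  shows "computable k (\<lambda>xs. h (F xs))"
  using computable_compose[of "[F]" "\<lambda>xs. h (xs ! 0)" k] assms by simp

lemma computable_compose2:
  assumes "computable 2 (\<lambda>xs. h (xs ! 0) (xs ! 1))" "computable k F" "computable k G"
  shows "computable k (\<lambda>xs. h (F xs) (G xs))"
  using computable_compose[of "[F, G]" "\<lambda>xs. h (xs ! 0) (xs ! 1)" k] assms
  by (auto simp: numeral_2_eq_2)

lemma computable_nth: "i < k \<Longrightarrow> computable k (\<lambda>xs. xs ! i)"
  unfolding computable_def using rec_eval_Proj by blast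

lemma computable_Suc: "computable k F \<Longrightarrow> computable k (\<lambda>xs. Suc (F xs))"
proof (erule computable_compose1[rotated])
  show "computable 1 (\<lambda>xs. Suc (xs ! 0))"
    unfolding computable_def
    by (rule exI[of _ Succ]) (auto simp: length_Suc_conv intro: rec_eval_Succ)
qed

lemma computable_const: "computable k (\<lambda>xs. c)"
proof (induction c)
  case 0
  show ?case unfolding computable_def using rec_eval_Zero by blast
qed (rule computable_Suc)

text \<open>With \<open>j = 2\<close> this discards the counter and the previous value, which the
  step function in \<open>computable_rec_nat\<close> receives in front of the parameters.\<close>

lemma computable_drop:
  assumes "computable k F"
  shows "computable (j + k) (\<lambda>xs. F (drop j xs))"
proof -
  have "computable (j + k) (\<lambda>xs. F (map (\<lambda>H. H xs) (map (\<lambda>i xs. xs ! (j + i)) [0..<k])))"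
    by (rule computable_compose) (use assms in \<open>auto intro: computable_nth\<close>)
  also have "?this \<longleftrightarrow> ?thesis"
    by (intro computable_cong arg_cong[of _ _ F]) (auto intro: nth_equalityI)
  finally show ?thesis .
qed

text \<open>\<open>PrimRec\<close> recurses on a separate first argument, while the number of rounds
  \<open>N\<close> depends on the parameters; composing with \<open>N\<close> and all projections
  bridges this.\<close>

lemma computable_rec_nat:
  assumes F: "computable k F" and G: "computable (Suc (Suc k)) G" and N: "computable k N"
  shows "computable k (\<lambda>xs. rec_nat (F xs) (\<lambda>n r. G (n # r # xs)) (N xs))"
proof -
  from F G obtain p q where
    p: "\<And>xs. length xs = k \<Longrightarrow> rec_eval (\<lambda>_. 0) p xs (F xs)" and
    q: "\<And>xs. length xs = Suc (Suc k) \<Longrightarrow> rec_eval (\<lambda>_. 0) q xs (G xs)"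
    unfolding computable_def by blast
  have "rec_eval (\<lambda>_. 0) (PrimRec p q) (n # xs) (rec_nat (F xs) (\<lambda>n r. G (n # r # xs)) n)"
    if "length xs = k" for n xs
    by (induction n) (use that p q in \<open>auto intro: rec_eval.intros\<close>)
  then have "computable (Suc k) (\<lambda>xs. rec_nat (F (tl xs)) (\<lambda>n r. G (n # r # tl xs)) (hd xs))"
    unfolding computable_def by (intro exI[of _ "PrimRec p q"]) (auto simp: length_Suc_conv)
  then have "computable (length (N # map (\<lambda>i xs. xs ! i) [0..<k]))
      (\<lambda>xs. rec_nat (F (tl xs)) (\<lambda>n r. G (n # r # tl xs)) (hd xs))"
    by simp
  moreover have "computable k H" if "H \<in> set (N # map (\<lambda>i xs. xs ! i) [0..<k])" for H
    using that N by (auto intro: computable_nth)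
  ultimately have "computable k (\<lambda>xs. rec_nat (F (map (\<lambda>i. xs ! i) [0..<k]))
      (\<lambda>n r. G (n # r # map (\<lambda>i. xs ! i) [0..<k])) (N xs))"
    using computable_compose[of "N # map (\<lambda>i xs. xs ! i) [0..<k]"
        "\<lambda>xs. rec_nat (F (tl xs)) (\<lambda>n r. G (n # r # tl xs)) (hd xs)" k]
    by (simp add: comp_def)
  also have "?this \<longleftrightarrow> ?thesis"
    by (intro computable_cong) (auto simp: map_nth)
  finally show ?thesis .
qed

text \<open>\<open>F\<close> is total, so the search of \<open>Mu\<close> is never blocked, and the
  second assumption makes it end.\<close>

lemma computable_Least:
  assumes "computable (Suc k) F" and "\<And>xs. length xs = k \<Longrightarrow> \<exists>y. F (y # xs) = 0"
  shows "computable k (\<lambda>xs. LEAST y. F (y # xs) = 0)"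
proof -
  from assms(1) obtain p where p: "\<And>xs. length xs = Suc k \<Longrightarrow> rec_eval (\<lambda>_. 0) p xs (F xs)"
    unfolding computable_def by blast
  have "rec_eval (\<lambda>_. 0) (Mu p) xs (LEAST y. F (y # xs) = 0)" if xs: "length xs = k" for xs
  proof (rule rec_eval_Mu)
    have "F ((LEAST y. F (y # xs) = 0) # xs) = 0"
      using assms(2)[OF xs] by (rule LeastI_ex)
    then show "rec_eval (\<lambda>_. 0) p ((LEAST y. F (y # xs) = 0) # xs) 0"
      using p[of "(LEAST y. F (y # xs) = 0) # xs"] xs by simp
  next
    fix z assume "z < (LEAST y. F (y # xs) = 0)"
    then have "F (z # xs) \<noteq> 0" by (rule not_less_Least)
    then show "\<exists>w. rec_eval (\<lambda>_. 0) p (z # xs) (Suc w)"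
      using p[of "z # xs"] xs by (metis length_Cons not0_implies_Suc)
  qed
  then show ?thesis unfolding computable_def by blast
qed

text \<open>Case distinction is primitive recursion on \<open>C\<close> whose step ignores the
  counter and the previous value.\<close>

lemma computable_if_zero:
  assumes "computable k C" "computable k F" "computable k G"
  shows "computable k (\<lambda>xs. if C xs = 0 then F xs else G xs)"
proof -
  have "computable (Suc (Suc k)) (\<lambda>xs. G (drop 2 xs))"
    using computable_drop[OF assms(3), of 2] by simp
  from computable_rec_nat[OF assms(2) this assms(1)]
  have "computable k (\<lambda>xs. rec_nat (F xs) (\<lambda>n r. G xs) (C xs))" by simp
  also have "(\<lambda>xs. rec_nat (F xs) (\<lambda>n r. G xs) (C xs)) = (\<lambda>xs. if C xs = 0 then F xs else G xs)"
    by (rule ext) (auto simp: gr0_conv_Suc)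
  finally show ?thesis .
qed

lemma computable_add:
  assumes "computable k F" "computable k G"
  shows "computable k (\<lambda>xs. F xs + G xs)"
proof -
  have "computable (Suc (Suc k)) (\<lambda>ys. Suc (ys ! 1))"
    by (intro computable_Suc computable_nth) simp
  from computable_rec_nat[OF assms(1) this assms(2)]
  have "computable k (\<lambda>xs. rec_nat (F xs) (\<lambda>n r. Suc r) (G xs))" by simp
  moreover have "rec_nat a (\<lambda>n r. Suc r) b = a + b" for a b
    by (induction b) auto
  ultimately show ?thesis by simp
qed

lemma computable_mult:
  assumes "computable k F" "computable k G"
  shows "computable k (\<lambda>xs. F xs * G xs)"
proof -
  have "computable (Suc (Suc k)) (\<lambda>ys. ys ! 1 + F (drop 2 ys))"
    using computable_drop[OF assms(1), of 2] by (intro computable_add computable_nth) auto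
  from computable_rec_nat[OF computable_const[of k 0] this assms(2)]
  have "computable k (\<lambda>xs. rec_nat 0 (\<lambda>n r. r + F xs) (G xs))" by simp
  moreover have "rec_nat 0 (\<lambda>n r. r + a) b = a * b" for a b :: nat
    by (induction b) auto
  ultimately show ?thesis by simp
qed

lemma computable_pred:
  assumes "computable k F"
  shows "computable k (\<lambda>xs. F xs - 1)"
proof -
  have "computable (Suc (Suc k)) (\<lambda>ys. ys ! 0)"
    by (intro computable_nth) simp
  from computable_rec_nat[OF computable_const[of k 0] this assms]
  have "computable k (\<lambda>xs. rec_nat 0 (\<lambda>n r. n) (F xs))" by simp
  moreover have "rec_nat 0 (\<lambda>n r. n) b = b - 1" for b :: nat
    by (cases b) auto
  ultimately show ?thesis by simp
qed

lemma computable_diff: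
  assumes "computable k F" "computable k G"
  shows "computable k (\<lambda>xs. F xs - G xs)"
proof -
  have "computable (Suc (Suc k)) (\<lambda>ys. ys ! 1 - 1)"
    by (intro computable_pred computable_nth) simp
  from computable_rec_nat[OF assms(1) this assms(2)]
  have "computable k (\<lambda>xs. rec_nat (F xs) (\<lambda>n r. r - 1) (G xs))" by simp
  moreover have "rec_nat a (\<lambda>n r. r - 1) b = a - b" for a b :: nat
    by (induction b) auto
  ultimately show ?thesis by simp
qed

lemma computable_if_eq:
  assumes "computable k C" "computable k D" "computable k F" "computable k G"
  shows "computable k (\<lambda>xs. if C xs = D xs then F xs else G xs)"
proof -
  have "computable k (\<lambda>xs. if (C xs - D xs) + (D xs - C xs) = 0 then F xs else G xs)"
    using assms by (intro computable_if_zero computable_add computable_diff)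
  also have "?this \<longleftrightarrow> ?thesis"
    by (rule computable_cong) auto
  finally show ?thesis .
qed

lemma computable_if_less:
  assumes "computable k C" "computable k D" "computable k F" "computable k G"
  shows "computable k (\<lambda>xs. if C xs < D xs then F xs else G xs)"
proof -
  have "computable k (\<lambda>xs. if D xs - C xs = 0 then G xs else F xs)"
    using assms by (intro computable_if_zero computable_diff)
  also have "?this \<longleftrightarrow> ?thesis"
    by (rule computable_cong) auto
  finally show ?thesis .
qed

lemma computable_bit:
  assumes "computable k F" "computable k G"
  shows "computable k (\<lambda>xs. of_bool (bit (F xs) (G xs)))"
proof -
  \<comment> \<open>The recursion works because \<open>n div 2 + Suc n div 2 = n\<close>.\<close>
  have half: "computable k (\<lambda>xs. F xs div 2)" if "computable k F" for k F
  proof -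
    have "computable (Suc (Suc k)) (\<lambda>ys. ys ! 0 - ys ! 1)"
      by (intro computable_diff computable_nth) auto
    from computable_rec_nat[OF computable_const[of k 0] this that]
    have "computable k (\<lambda>xs. rec_nat 0 (\<lambda>n r. n - r) (F xs))" by simp
    moreover have "rec_nat 0 (\<lambda>n r. n - r) b = b div 2" for b :: nat
      by (induction b) auto
    ultimately show ?thesis by simp
  qed
  have parity: "computable k (\<lambda>xs. of_bool (odd (F xs)))" if "computable k F" for k F
  proof -
    have "computable (Suc (Suc k)) (\<lambda>ys. 1 - ys ! 1)"
      by (intro computable_diff computable_const computable_nth) auto
    from computable_rec_nat[OF computable_const[of k 0] this that]
    have "computable k (\<lambda>xs. rec_nat 0 (\<lambda>n r. 1 - r) (F xs))" by simp
    moreover have "rec_nat 0 (\<lambda>n r. 1 - r) b = (of_bool (odd b) :: nat)" for b :: nat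
      by (induction b) auto
    ultimately show ?thesis by simp
  qed
  have "computable (Suc (Suc k)) (\<lambda>ys. ys ! 1 div 2)"
    by (intro half computable_nth) auto
  from computable_rec_nat[OF assms(1) this assms(2)]
  have "computable k (\<lambda>xs. rec_nat (F xs) (\<lambda>n r. r div 2) (G xs))" by simp
  moreover have "rec_nat a (\<lambda>n r. r div 2) b = a div 2 ^ b" for a b :: nat
    by (induction b) (auto simp: power_Suc2 div_mult2_eq simp del: power_Suc)
  ultimately have "computable k (\<lambda>xs. F xs div 2 ^ G xs)" by simp
  from parity[OF this] show ?thesis by (simp add: bit_iff_odd)
qed

text \<open>Finitely many values may be hard-wired, one per induction step, without any effective
  way of finding them. This handles the stem of the cylinder and the exceptional arguments of
  \<open>g\<close>.\<close>

lemma computable_finite_change: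
  assumes "finite F" "computable 1 (\<lambda>xs. h (xs ! 0))" "\<And>n. n \<notin> F \<Longrightarrow> h' n = h n"
  shows "computable 1 (\<lambda>xs. h' (xs ! 0))"
  using assms(1,3)
proof (induction F arbitrary: h' rule: finite_induct)
  case empty
  then have "h' = h" by auto
  with assms(2) show ?case by simp
next
  case (insert a F)
  have "computable 1 (\<lambda>xs. (h'(a := h a)) (xs ! 0))"
    by (rule insert.IH) (use insert.prems in auto)
  then have "computable 1 (\<lambda>xs. if xs ! 0 = a then h' a else (h'(a := h a)) (xs ! 0))"
    by (intro computable_if_eq computable_nth computable_const) auto
  also have "?this \<longleftrightarrow> ?case"
    by (rule computable_cong) auto
  finally show ?case .
qed

lemma recursive_if_computable: "computable 1 (\<lambda>xs. h (xs ! 0)) \<Longrightarrow> recursive h"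
  unfolding recursive_iff_recursive_in_zero recursive_in_def computable_def
  by (metis One_nat_def length_Cons list.size(3) nth_Cons_0)

section \<open>Evaluation with truncated searches\<close>

text \<open>
  Only the unbounded searches are cut off, at \<open>s\<close>.  The result \<open>0\<close> means
  \<open>no value\<close> and \<open>Suc y\<close> means \<open>value y\<close>.
\<close>

primrec bounded_eval :: "recf \<Rightarrow> nat \<Rightarrow> (nat \<Rightarrow> nat) \<Rightarrow> nat list \<Rightarrow> nat" where
  "bounded_eval Zero s g xs = 1"
| "bounded_eval Succ s g xs = (if length xs = 1 then Suc (Suc (xs ! 0)) else 0)"
| "bounded_eval (Proj i) s g xs = (if i < length xs then Suc (xs ! i) else 0)"
| "bounded_eval Oracle s g xs = (if length xs = 1 then Suc (g (xs ! 0)) else 0)"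
| "bounded_eval (Comp p qs) s g xs =
    (let ys = map (\<lambda>e. e s g xs) (map bounded_eval qs)
     in if prod_list ys = 0 then 0 else bounded_eval p s g (map (\<lambda>y. y - 1) ys))"
| "bounded_eval (PrimRec p q) s g xs =
    (if xs = [] then 0 else
      rec_nat (bounded_eval p s g (tl xs))
        (\<lambda>n r. if r = 0 then 0 else bounded_eval q s g (n # (r - 1) # tl xs)) (hd xs))"
| "bounded_eval (Mu p) s g xs =
    (let y = (LEAST y. (if y = s then 0 else bounded_eval p s g (y # xs) - 1) = 0)
     in if bounded_eval p s g (y # xs) = 1 then Suc y else 0)"

text \<open>Truncation can lose a value but not change one: a search result is accepted only if it
  is a true zero, and any undefined or zero value before it would have stopped the search
  earlier.\<close>

lemma bounded_eval_sound: "bounded_eval p s g xs = Suc y \<Longrightarrow> rec_eval g p xs y"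
proof (induction p arbitrary: xs y)
  case (Comp p qs)
  define ys where "ys = map (\<lambda>q. bounded_eval q s g xs) qs"
  have ys: "prod_list ys \<noteq> 0" "bounded_eval p s g (map (\<lambda>y. y - 1) ys) = Suc y"
    using Comp.prems by (auto simp: ys_def Let_def comp_def split: if_splits)
  show ?case
  proof (rule rec_eval_Comp)
    show "rec_eval g p (map (\<lambda>y. y - 1) ys) y" using ys(2) by (rule Comp.IH)
    show "list_all2 (\<lambda>q y. rec_eval g q xs y) qs (map (\<lambda>y. y - 1) ys)"
      unfolding list_all2_conv_all_nth
    proof (intro conjI allI impI)
      fix i assume i: "i < length qs"
      then have "ys ! i \<in> set ys" by (simp add: ys_def)
      with ys(1) have "ys ! i \<noteq> 0" by (metis prod_list_zero_iff)
      then have "bounded_eval (qs ! i) s g xs = Suc (ys ! i - 1)" using i by (simp add: ys_def)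
      then show "rec_eval g (qs ! i) xs (map (\<lambda>y. y - 1) ys ! i)"
        using i Comp.IH(2)[of "qs ! i"] by (simp add: ys_def)
    qed (simp add: ys_def)
  qed
next
  case (PrimRec p q)
  then obtain n zs where xs: "xs = n # zs" by (cases xs) auto
  define R where "R = rec_nat (bounded_eval p s g zs)
    (\<lambda>n r. if r = 0 then 0 else bounded_eval q s g (n # (r - 1) # zs))"
  have "R n = Suc y \<Longrightarrow> rec_eval g (PrimRec p q) (n # zs) y" for n y
  proof (induction n arbitrary: y)
    case 0
    then show ?case by (auto simp: R_def intro: rec_eval_PrimRec_0 PrimRec.IH)
  next
    case (Suc n)
    then obtain r where "R n = Suc r" "bounded_eval q s g (n # r # zs) = Suc y"
      by (cases "R n") (auto simp: R_def)
    then show ?case by (auto intro: rec_eval_PrimRec_Suc Suc.IH PrimRec.IH)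
  qed
  with PrimRec.prems show ?case by (simp add: xs R_def cong: if_cong)
next
  case (Mu p)
  \<comment> \<open>The search stops at \<open>s\<close> at the latest, and also where
    \<open>p\<close> has no value, since \<open>0 - 1 = 0\<close>. Failure of \<open>P\<close>
    therefore means a result of at least 2, that is, a defined nonzero value.\<close>
  define P where "P y \<longleftrightarrow> (if y = s then 0 else bounded_eval p s g (y # xs) - 1) = 0" for y
  have y: "y = (LEAST y. P y)" "bounded_eval p s g (y # xs) = 1"
    using Mu.prems unfolding P_def bounded_eval.simps Let_def by (metis nat.distinct(1) nat.inject)+
  show ?case
  proof (rule rec_eval_Mu)
    show "rec_eval g p (y # xs) 0" using y(2) by (intro Mu.IH) simp
    fix z assume "z < y"
    then have "\<not> P z" using y(1) not_less_Least by blast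
    then have "bounded_eval p s g (z # xs) = Suc (Suc (bounded_eval p s g (z # xs) - 2))"
      by (auto simp: P_def split: if_splits)
    then show "\<exists>w. rec_eval g p (z # xs) (Suc w)" using Mu.IH by blast
  qed
qed (auto split: if_splits simp: length_Suc_conv intro: rec_eval.intros)

text \<open>This also contains the use principle: halting computations see a finite part of the oracle.\<close>

lemma bounded_eval_complete:
  assumes "rec_eval g p xs y"
  shows "\<exists>u. \<forall>s\<ge>u. \<forall>g'. (\<forall>i<u. g' i = g i) \<longrightarrow> bounded_eval p s g' xs = Suc y"
  using assms
proof (induction rule: rec_eval.induct)
  case (rec_eval_Oracle x)
  \<comment> \<open>The bound must exceed the queried position \<open>x\<close>.\<close>
  show ?case by (rule exI[of _ "Suc x"]) simp
next
  case (rec_eval_Comp xs qs ys p z)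
  from rec_eval_Comp.IH(1) have len: "length ys = length qs" and
    "\<forall>i<length qs. \<exists>u. \<forall>s\<ge>u. \<forall>g'. (\<forall>i<u. g' i = g i) \<longrightarrow>
      bounded_eval (qs ! i) s g' xs = Suc (ys ! i)"
    by (auto simp: list_all2_conv_all_nth)
  then obtain u where u: "\<And>i s g'. i < length qs \<Longrightarrow> u i \<le> s \<Longrightarrow> (\<forall>j<u i. g' j = g j) \<Longrightarrow>
      bounded_eval (qs ! i) s g' xs = Suc (ys ! i)"
    by metis
  from rec_eval_Comp.IH(2) obtain v where v: "\<And>s g'. v \<le> s \<Longrightarrow> (\<forall>j<v. g' j = g j) \<Longrightarrow>
      bounded_eval p s g' ys = Suc z"
    by blast
  \<comment> \<open>The sum is a common bound for the finitely many computations of the arguments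
    and for \<open>p\<close>.\<close>
  define w where "w = v + (\<Sum>i<length qs. u i)"
  have uw: "u i \<le> w" if "i < length qs" for i
    using member_le_sum[of i "{..<length qs}" u] that by (simp add: w_def)
  show ?case
  proof (intro exI[of _ w] allI impI)
    fix s g' assume s: "w \<le> s" and g': "\<forall>i<w. g' i = g i"
    have "bounded_eval (qs ! i) s g' xs = Suc (ys ! i)" if "i < length qs" for i
      using u[OF that] uw[OF that] s g' by (meson le_trans less_le_trans)
    then have *: "map (\<lambda>q. bounded_eval q s g' xs) qs = map Suc ys"
      using len by (auto intro: nth_equalityI)
    have "bounded_eval p s g' ys = Suc z"
      by (rule v) (use s g' in \<open>auto simp: w_def\<close>)
    with * show "bounded_eval (Comp p qs) s g' xs = Suc z"
      by (simp add: comp_def prod_list_zero_iff image_iff)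
  qed
next
  case (rec_eval_PrimRec_0 p xs y q)
  then show ?case by simp
next
  case (rec_eval_PrimRec_Suc p q n xs r y)
  then obtain u v where
    u: "\<forall>s\<ge>u. \<forall>g'. (\<forall>i<u. g' i = g i) \<longrightarrow> bounded_eval (PrimRec p q) s g' (n # xs) = Suc r" and
    v: "\<forall>s\<ge>v. \<forall>g'. (\<forall>i<v. g' i = g i) \<longrightarrow> bounded_eval q s g' (n # r # xs) = Suc y"
    by blast
  show ?case
  proof (intro exI[of _ "max u v"] allI impI)
    fix s g' assume "max u v \<le> s" "\<forall>i<max u v. g' i = g i"
    with u v have "bounded_eval (PrimRec p q) s g' (n # xs) = Suc r"
      "bounded_eval q s g' (n # r # xs) = Suc y" by auto
    then show "bounded_eval (PrimRec p q) s g' (Suc n # xs) = Suc y" by (simp cong: if_cong)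
  qed
next
  case (rec_eval_Mu p y xs)
  from rec_eval_Mu.IH(1) obtain v where v: "\<And>s g'. v \<le> s \<Longrightarrow> (\<forall>i<v. g' i = g i) \<Longrightarrow>
      bounded_eval p s g' (y # xs) = Suc 0"
    by blast
  have "\<forall>z<y. \<exists>u w. \<forall>s\<ge>u. \<forall>g'. (\<forall>i<u. g' i = g i) \<longrightarrow>
      bounded_eval p s g' (z # xs) = Suc (Suc w)"
    using rec_eval_Mu.IH(2) by blast
  then obtain u w where u: "\<And>z s g'. z < y \<Longrightarrow> u z \<le> s \<Longrightarrow> (\<forall>i<u z. g' i = g i) \<Longrightarrow>
      bounded_eval p s g' (z # xs) = Suc (Suc (w z))"
    by metis
  \<comment> \<open>The summand \<open>y\<close> ensures \<open>y \<le> s\<close>, so the truncation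
    does not stop the search before \<open>y\<close>.\<close>
  define b where "b = y + v + (\<Sum>z<y. u z)"
  have ub: "u z \<le> b" if "z < y" for z
    using member_le_sum[of z "{..<y}" u] that by (simp add: b_def)
  show ?case
  proof (intro exI[of _ b] allI impI)
    fix s g' assume s: "b \<le> s" and g': "\<forall>i<b. g' i = g i"
    have below: "bounded_eval p s g' (z # xs) = Suc (Suc (w z))" if "z < y" for z
      using u[OF that] ub[OF that] s g' by (meson le_trans less_le_trans)
    have y: "bounded_eval p s g' (y # xs) = Suc 0"
      by (rule v) (use s g' in \<open>auto simp: b_def\<close>)
    have "(LEAST z. (if z = s then 0 else bounded_eval p s g' (z # xs) - 1) = 0) = y"
    proof (rule Least_equality)
      fix z assume z: "(if z = s then 0 else bounded_eval p s g' (z # xs) - 1) = 0"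
      show "y \<le> z"
      proof (rule ccontr)
        assume "\<not> y \<le> z"
        then have "z < y" "z \<noteq> s" using s by (auto simp: b_def)
        with z below[of z] show False by simp
      qed
    qed (simp add: y)
    then show "bounded_eval (Mu p) s g' xs = Suc y" using y by simp
  qed
qed auto

text \<open>All searches are truncated, so the evaluation is total and is built from the closure
  lemmas, clause by clause. The number at position 0 is both the truncation bound and the code of
  the oracle, so one later search variable can serve for both.\<close>

lemma computable_bounded_eval:
  assumes L: "computable 2 (\<lambda>xs. L (xs ! 0) (xs ! 1))"
  shows "computable (Suc k) (\<lambda>xs. bounded_eval p (xs ! 0) (L (xs ! 0)) (tl xs))"
proof (induction p arbitrary: k)
  case Zero
  show ?case by (simp add: computable_const)
next
  case Succ
  show ?case
  proof (cases "k = 1")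
    case True
    have "computable (Suc k) (\<lambda>xs. Suc (Suc (xs ! 1)))"
      using True by (intro computable_Suc computable_nth) simp
    also have "?this \<longleftrightarrow> ?thesis" using True by (intro computable_cong) (auto simp: nth_tl)
    finally show ?thesis .
  next
    case False
    have "computable (Suc k) (\<lambda>xs. 0)" by (rule computable_const)
    also have "?this \<longleftrightarrow> ?thesis" using False by (intro computable_cong) auto
    finally show ?thesis .
  qed
next
  case (Proj i)
  show ?case
  proof (cases "i < k")
    case True
    have "computable (Suc k) (\<lambda>xs. Suc (xs ! Suc i))"
      using True by (intro computable_Suc computable_nth) simp
    also have "?this \<longleftrightarrow> ?thesis" using True by (intro computable_cong) (auto simp: nth_tl)
    finally show ?thesis .
  next
    case False
    have "computable (Suc k) (\<lambda>xs. 0)" by (rule computable_const)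
    also have "?this \<longleftrightarrow> ?thesis" using False by (intro computable_cong) auto
    finally show ?thesis .
  qed
next
  case Oracle
  show ?case
  proof (cases "k = 1")
    case True
    have "computable (Suc k) (\<lambda>xs. Suc (L (xs ! 0) (xs ! 1)))"
      using True by (intro computable_Suc computable_compose2[OF L] computable_nth) simp_all
    also have "?this \<longleftrightarrow> ?thesis" using True by (intro computable_cong) (auto simp: nth_tl)
    finally show ?thesis .
  next
    case False
    have "computable (Suc k) (\<lambda>xs. 0)" by (rule computable_const)
    also have "?this \<longleftrightarrow> ?thesis" using False by (intro computable_cong) auto
    finally show ?thesis .
  qed
next
  case (Comp p qs)
  let ?E = "\<lambda>q xs. bounded_eval q (xs ! 0) (L (xs ! 0)) (tl xs)"
  \<comment> \<open>Sublists \<open>rs\<close> allow an induction over the list while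
    \<open>Comp.IH\<close> covers members of \<open>qs\<close> only.\<close>
  have prod: "computable (Suc k) (\<lambda>xs. prod_list (map (\<lambda>q. ?E q xs) rs))"
    if "set rs \<subseteq> set qs" for rs
    using that by (induction rs) (auto intro: computable_const computable_mult Comp.IH)
  have "computable (Suc k) (\<lambda>xs. ?E p (map (\<lambda>F. F xs)
      ((\<lambda>xs. xs ! 0) # map (\<lambda>q xs. ?E q xs - 1) qs)))"
  proof (rule computable_compose)
    show "computable (length ((\<lambda>xs. xs ! 0) # map (\<lambda>q xs. ?E q xs - 1) qs)) (?E p)"
      using Comp.IH(1)[of "length qs"] by simp
    show "computable (Suc k) F" if "F \<in> set ((\<lambda>xs. xs ! 0) # map (\<lambda>q xs. ?E q xs - 1) qs)" for F
      using that Comp.IH(2) computable_pred by (auto intro: computable_nth)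
  qed
  then have "computable (Suc k) (\<lambda>xs. if prod_list (map (\<lambda>q. ?E q xs) qs) = 0 then 0
      else ?E p (xs ! 0 # map (\<lambda>q. ?E q xs - 1) qs))"
    by (intro computable_if_zero prod computable_const) (auto simp: comp_def)
  then show ?case by (simp add: Let_def comp_def cong: if_cong)
next
  case (PrimRec p q)
  let ?E = "\<lambda>q xs. bounded_eval q (xs ! 0) (L (xs ! 0)) (tl xs)"
  show ?case
  proof (cases k)
    case 0
    have "computable (Suc k) (\<lambda>xs. 0)" by (rule computable_const)
    also have "?this \<longleftrightarrow> ?thesis"
      using 0 by (intro computable_cong) (auto simp: length_Suc_conv)
    finally show ?thesis .
  next
    case (Suc j)
    \<comment> \<open>The arguments are the stage, the recursion argument and \<open>j\<close>
      parameters. In \<open>?Gs\<close> the counter and the previous result stand in front of them,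
      and \<open>xs ! 1 - 1\<close> undoes the \<open>Suc\<close> that marks a value.\<close>
    let ?Fs = "(\<lambda>xs. xs ! 0) # map (\<lambda>i xs. xs ! (i + 2)) [0..<j]"
    let ?Gs = "(\<lambda>xs. xs ! 2) # (\<lambda>xs. xs ! 0) # (\<lambda>xs. xs ! 1 - 1) # map (\<lambda>i xs. xs ! (i + 4)) [0..<j]"
    have F: "computable (Suc k) (\<lambda>xs. ?E p (map (\<lambda>F. F xs) ?Fs))"
      by (rule computable_compose) (use PrimRec.IH(1)[of j] Suc in \<open>auto intro: computable_nth\<close>)
    have "computable (Suc (Suc (Suc k))) (\<lambda>xs. ?E q (map (\<lambda>F. F xs) ?Gs))"
    proof (rule computable_compose)
      show "computable (length ?Gs) (?E q)" using PrimRec.IH(2)[of "Suc (Suc j)"] by simp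
      show "computable (Suc (Suc (Suc k))) F" if "F \<in> set ?Gs" for F
        using that Suc computable_pred[OF computable_nth[of 1 "Suc (Suc (Suc k))"]]
        by (auto intro: computable_nth)
    qed
    then have G: "computable (Suc (Suc (Suc k)))
        (\<lambda>xs. if xs ! 1 = 0 then 0 else ?E q (map (\<lambda>F. F xs) ?Gs))"
      by (intro computable_if_zero computable_const computable_nth) auto
    have N: "computable (Suc k) (\<lambda>xs. xs ! 1)" using Suc by (intro computable_nth) simp
    note computable_rec_nat[OF F G N]
    also have "computable (Suc k) (\<lambda>xs. rec_nat (?E p (map (\<lambda>F. F xs) ?Fs))
        (\<lambda>n r. if (n # r # xs) ! 1 = 0 then 0 else ?E q (map (\<lambda>F. F (n # r # xs)) ?Gs)) (xs ! 1))
        \<longleftrightarrow> ?thesis"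
    proof (rule computable_cong)
      fix xs :: "nat list" assume "length xs = Suc k"
      then obtain e n zs where xs: "xs = e # n # zs" "length zs = j"
        using Suc by (auto simp: length_Suc_conv)
      have "map (\<lambda>i. zs ! i) [0..<j] = zs" using xs map_nth by blast
      then show "rec_nat (?E p (map (\<lambda>F. F xs) ?Fs))
        (\<lambda>n r. if (n # r # xs) ! 1 = 0 then 0 else ?E q (map (\<lambda>F. F (n # r # xs)) ?Gs)) (xs ! 1) =
        bounded_eval (PrimRec p q) (xs ! 0) (L (xs ! 0)) (tl xs)"
        by (simp add: xs comp_def cong: if_cong)
    qed
    finally show ?thesis .
  qed
next
  case (Mu p)
  let ?E = "\<lambda>xs. bounded_eval p (xs ! 0) (L (xs ! 0)) (tl xs)"
  let ?Fs = "(\<lambda>xs. xs ! 1) # (\<lambda>xs. xs ! 0) # map (\<lambda>i xs. xs ! (i + 2)) [0..<k]"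
  \<comment> \<open>The search variable comes first and the stage second; the candidate equal to the
    stage counts as a zero, so the search always ends.\<close>
  let ?H = "\<lambda>xs. if xs ! 0 = xs ! 1 then 0 else ?E (map (\<lambda>F. F xs) ?Fs) - 1"
  define y where "y xs = (LEAST y. ?H (y # xs) = 0)" for xs
  have "computable (Suc (Suc k)) (\<lambda>xs. ?E (map (\<lambda>F. F xs) ?Fs))"
    by (rule computable_compose) (use Mu.IH[of "Suc k"] in \<open>auto intro: computable_nth\<close>)
  then have "computable (Suc (Suc k)) ?H"
    by (intro computable_if_eq computable_pred computable_const computable_nth) auto
  then have y: "computable (Suc k) y"
    unfolding y_def by (rule computable_Least) (metis nth_Cons_0 nth_Cons_Suc One_nat_def)
  let ?Gs = "(\<lambda>xs. xs ! 0) # y # map (\<lambda>i xs. xs ! (i + 1)) [0..<k]"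
  have "computable (Suc k) (\<lambda>xs. ?E (map (\<lambda>F. F xs) ?Gs))"
    by (rule computable_compose) (use Mu.IH[of "Suc k"] y in \<open>auto intro: computable_nth\<close>)
  then have "computable (Suc k) (\<lambda>xs. if ?E (map (\<lambda>F. F xs) ?Gs) = 1 then Suc (y xs) else 0)"
    using y by (intro computable_if_eq computable_Suc computable_const)
  also have "?this \<longleftrightarrow> ?case"
  proof (rule computable_cong)
    fix xs :: "nat list" assume "length xs = Suc k"
    then obtain e zs where xs: "xs = e # zs" "length zs = k"
      by (auto simp: length_Suc_conv)
    have zs: "map (\<lambda>i. zs ! i) [0..<k] = zs" using xs map_nth by blast
    have "y xs = (LEAST y. (if y = e then 0 else bounded_eval p e (L e) (y # zs) - 1) = 0)"
      unfolding y_def using zs by (simp add: xs comp_def)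
    then show "(if ?E (map (\<lambda>F. F xs) ?Gs) = 1 then Suc (y xs) else 0) =
        bounded_eval (Mu p) (xs ! 0) (L (xs ! 0)) (tl xs)"
      using zs by (simp add: xs comp_def Let_def)
  qed
  finally show ?case .
qed

section \<open>The Baire category argument\<close>

instance recf :: countable
  by countable_datatype

text \<open>A finite string is represented by a total sequence and a length: \<open>S\<close>,
  \<open>l\<close> give the cylinder, and \<open>A\<close>, \<open>m\<close> an arbitrary basic
  neighbourhood of a point of it.\<close>

definition reduces_densely :: "(nat \<Rightarrow> nat) \<Rightarrow> recf \<Rightarrow> cantor \<Rightarrow> nat \<Rightarrow> bool" where
  "reduces_densely g p S l \<longleftrightarrow> (\<forall>A m. (\<forall>i<l. A i = S i) \<longrightarrow>
    (\<exists>X. (\<forall>i<m. X i = A i) \<and> (\<forall>n. rec_eval (\<lambda>n. of_bool (X n)) p [n] (of_bool (X (g n))))))"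

text \<open>
  A Baire category argument: the programs are countably many, so one of them works for a
  dense set of oracles in some cylinder.
\<close>

lemma reduction_dense_in_cylinder:
  fixes g :: "nat \<Rightarrow> nat"
  assumes "\<And>A. (\<lambda>n. A (g n)) \<le>\<^sub>T A"
  obtains p S l where "reduces_densely g p S l"
proof (rule ccontr)
  define C where "C p X \<longleftrightarrow> (\<forall>n. rec_eval (\<lambda>n. of_bool (X n)) p [n] (of_bool (X (g n))))" for p X
  assume "\<not> thesis"
  then have "\<not> reduces_densely g p S l" for p l S
    using that by blast
  then have ex: "\<exists>A m. (\<forall>i<l. A i = S i) \<and> \<not> (\<exists>X. (\<forall>i<m. X i = A i) \<and> C p X)" for p l S
    unfolding reduces_densely_def C_def by (simp only: not_all not_imp)
  \<comment> \<open>One step of the diagonal construction: shrink the cylinder \<open>c\<close> to a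
    cylinder \<open>d\<close> that avoids program number \<open>n\<close> altogether.\<close>
  define R where "R n c d \<longleftrightarrow> snd c < snd d \<and> (\<forall>i<snd c. fst d i = fst c i) \<and>
    (\<forall>X. (\<forall>i<snd d. X i = fst d i) \<longrightarrow> \<not> C (from_nat n) X)"
    for n :: nat and c d :: "cantor \<times> nat"
  have step: "\<exists>d. True \<and> R n c d" for n c
  proof -
    from ex[of "snd c" "fst c" "from_nat n"] obtain A m where
      A: "\<forall>i<snd c. A i = fst c i" and neg: "\<not> (\<exists>X. (\<forall>i<m. X i = A i) \<and> C (from_nat n) X)"
      by (elim exE conjE)
    \<comment> \<open>Taking the maximum with \<open>Suc (snd c)\<close> makes the lengths strictly
      increase, so that the cylinders shrink to a single point.\<close>
    have "\<not> C (from_nat n) X" if "\<forall>i<max m (Suc (snd c)). X i = A i" for X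
    proof
      assume "C (from_nat n) X"
      moreover have "\<forall>i<m. X i = A i" using that by simp
      ultimately show False using neg[unfolded not_ex, rule_format, of X] by simp
    qed
    with A have "R n c (A, max m (Suc (snd c)))"
      unfolding R_def by simp
    then show ?thesis by blast
  qed
  have "\<exists>f. \<forall>n. True \<and> R n (f n) (f (Suc n))"
    by (rule dependent_nat_choice) (simp, rule step)
  then obtain f where "\<And>n. R n (f n) (f (Suc n))" by blast
  then have f: "\<And>n. snd (f n) < snd (f (Suc n))"
    "\<And>n i. i < snd (f n) \<Longrightarrow> fst (f (Suc n)) i = fst (f n) i"
    "\<And>n X. (\<forall>i<snd (f (Suc n)). X i = fst (f (Suc n)) i) \<Longrightarrow> \<not> C (from_nat n) X"
    unfolding R_def by simp_all
  have mono: "strict_mono (\<lambda>n. snd (f n))"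
    using f(1) by (simp add: strict_mono_Suc_iff)
  have stable: "fst (f m) i = fst (f n) i" if "i < snd (f n)" "n \<le> m" for i m n
    using that(2)
  proof (induction m rule: dec_induct)
    case (step m)
    have "i < snd (f m)"
      using that(1) step.hyps(1) mono by (metis less_le_trans strict_mono_less_eq)
    then show ?case using f(2) step.IH by simp
  qed simp
  \<comment> \<open>The length of cylinder number \<open>Suc i\<close> exceeds \<open>i\<close>, so
    bit \<open>i\<close> is settled there.\<close>
  define X where "X i = fst (f (Suc i)) i" for i
  have X: "X i = fst (f n) i" if "i < snd (f n)" for i n
  proof -
    have "i < snd (f (Suc i))"
      using strict_mono_imp_increasing[OF mono, of "Suc i"] by simp
    then show ?thesis
      using that stable unfolding X_def by (metis nat_le_linear)
  qed
  have "\<not> C (from_nat n) X" for n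
    by (rule f(3)) (simp add: X)
  then have "\<not> C (from_nat (to_nat p)) X" for p :: recf .
  then have "\<not> C p X" for p
    by simp
  with assms[of X] show False
    unfolding turing_le_def recursive_in_def C_def by blast
qed

section \<open>Recovering \<open>g\<close> from a densely correct program\<close>

text \<open>The root is the least \<open>q\<close> with \<open>e < (q + 1)^2\<close>, a condition
  expressed by truncated subtraction. It serves to decode pairs stored as
  \<open>t * t + d\<close>.\<close>

lemma computable_floor_sqrt:
  assumes "computable k F"
  shows "computable k (\<lambda>xs. floor_sqrt (F xs))"
proof (rule computable_compose1[OF _ assms])
  have "computable (Suc 1) (\<lambda>ys. Suc (ys ! 1) - Suc (ys ! 0) * Suc (ys ! 0))"
    by (intro computable_diff computable_Suc computable_mult computable_nth) auto
  then have "computable 1 (\<lambda>xs. LEAST q. Suc ((q # xs) ! 1) - Suc ((q # xs) ! 0) * Suc ((q # xs) ! 0) = 0)"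
  proof (rule computable_Least)
    show "\<exists>y. Suc ((y # xs) ! 1) - Suc ((y # xs) ! 0) * Suc ((y # xs) ! 0) = 0" for xs :: "nat list"
      by (rule exI[of _ "xs ! 0"]) simp
  qed
  moreover have "(LEAST q. Suc e - Suc q * Suc q = 0) = floor_sqrt e" for e
  proof (rule Least_equality)
    show "Suc e - Suc (floor_sqrt e) * Suc (floor_sqrt e) = 0"
      using Suc_floor_sqrt_power2_gt[of e] unfolding power2_eq_square by linarith
    show "floor_sqrt e \<le> q" if "Suc e - Suc q * Suc q = 0" for q
    proof -
      have "e < (Suc q)\<^sup>2" using that unfolding power2_eq_square by linarith
      then show ?thesis by (metis floor_sqrt_power2_le leD le_less_trans linorder_not_less not_less_eq_eq power2_nat_le_eq_le)
    qed
  qed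
  ultimately show "computable 1 (\<lambda>xs. floor_sqrt (xs ! 0))" by simp
qed

text \<open>The bits from \<open>N\<close> on are free, so a code of a finite oracle can be taken as
  large as desired.\<close>

lemma nat_with_initial_bits: "\<exists>t\<ge>M. \<forall>i<N. bit (t :: nat) i = A i"
proof (induction N arbitrary: A)
  case (Suc N)
  from Suc[of "\<lambda>i. A (Suc i)"] obtain t where t: "M \<le> t" "\<forall>i<N. bit t i = A (Suc i)" by blast
  have "bit (of_bool (A 0) + 2 * t) i = A i" if "i < Suc N" for i
    using that t(2) by (cases i) (auto simp: bit_0 bit_Suc)
  moreover have "M \<le> of_bool (A 0) + 2 * t" using t(1) by simp
  ultimately show ?case by blast
qed auto

lemma computable_if_pullback_below:
  fixes g :: "nat \<Rightarrow> nat"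
  assumes "inj g" and red: "\<And>A. (\<lambda>n. A (g n)) \<le>\<^sub>T A"
  shows "computable 1 (\<lambda>xs. g (xs ! 0))"
proof -
  obtain p S l where "reduces_densely g p S l"
    using reduction_dense_in_cylinder[OF red] .
  then have dense: "\<exists>X. (\<forall>i<m. X i = A i) \<and>
      (\<forall>n. rec_eval (\<lambda>n. of_bool (X n)) p [n] (of_bool (X (g n))))" if "\<forall>i<l. A i = S i" for A m
    using that unfolding reduces_densely_def by simp
  define pos where "pos e = l + (e - floor_sqrt e * floor_sqrt e)" for e
  \<comment> \<open>\<open>e\<close> encodes a position \<open>pos e \<ge> l\<close> and a finite oracle in the cylinder, whose value at
    that position is replaced by \<open>v\<close>.\<close>
  define L where "L v e i = (if i = pos e then v else if i < l then of_bool (S i)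
    else of_bool (bit (floor_sqrt e) i))" for v e i :: nat
  \<comment> \<open>The results 1 and 2 stand for the outputs 0 and 1: \<open>T e n = 0\<close> says
    that, within stage \<open>e\<close>, the output at \<open>n\<close> is the bit written at
    \<open>pos e\<close>, for both choices of this bit.\<close>
  define T where "T e n = (if bounded_eval p e (L 0 e) [n] = 1
    then if bounded_eval p e (L 1 e) [n] = 2 then 0 else 1 else 1 :: nat)" for e n
  \<comment> \<open>For these \<open>n\<close> the search for a zero of \<open>T\<close> must fail,
    because \<open>pos e \<ge> l\<close> while a zero forces \<open>pos e = g n\<close>. Injectivity
    of \<open>g\<close> makes them finitely many.\<close>
  define F where "F = {n. g n < l}"
  have "finite F"
    using finite_vimageI[OF finite_lessThan[of l] \<open>inj g\<close>] by (simp add: F_def vimage_def)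

  have T_pos: "pos e = g n" if "T e n = 0" for e n
  proof (rule ccontr)
    assume neq: "pos e \<noteq> g n"
    \<comment> \<open>Density gives a set \<open>X\<close> on which \<open>p\<close> is correct and
      which agrees with \<open>L v e\<close> on the use of the computation and at
      \<open>g n\<close>. The output \<open>v\<close> must then be the bit of \<open>X\<close> at
      \<open>g n\<close>.\<close>
    have "L v e (g n) = v" if v: "v < 2" and ev: "bounded_eval p e (L v e) [n] = Suc v" for v
    proof -
      from bounded_eval_complete[OF bounded_eval_sound[OF ev]] obtain u where
        u: "\<And>g'. (\<forall>i<u. g' i = L v e i) \<Longrightarrow> bounded_eval p u g' [n] = Suc v"
        by blast
      have bin: "of_bool (L v e i = 1) = L v e i" for i
        using v by (auto simp: L_def)
      have "\<forall>i<l. (L v e i = 1) = S i" by (auto simp: L_def pos_def)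
      from dense[OF this, of "max u (Suc (g n))"] obtain X where
        X: "\<forall>i<max u (Suc (g n)). X i = (L v e i = 1)" and
        red: "\<And>n. rec_eval (\<lambda>n. of_bool (X n)) p [n] (of_bool (X (g n)))"
        by blast
      have "rec_eval (\<lambda>n. of_bool (X n)) p [n] v"
        by (rule bounded_eval_sound, rule u) (use X bin in auto)
      from rec_eval_det[OF this red] show ?thesis using X bin by auto
    qed
    \<comment> \<open>Away from \<open>pos e\<close> the oracle \<open>L v e\<close> does not depend
      on \<open>v\<close>, so its value at \<open>g n\<close> cannot be both 0 and 1.\<close>
    from this[of 0] this[of 1] that have "L 0 e (g n) = 0" "L 1 e (g n) = 1"
      by (auto simp: T_def split: if_splits)
    with neq show False by (auto simp: L_def)
  qed

  have T_ex: "\<exists>e. T e n = 0" if "l \<le> g n" for n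
  proof -
    have "\<forall>i<l. (S(g n := False)) i = S i" using that by auto
    from dense[OF this, of "Suc (g n)"] obtain X where
      X: "\<forall>i<Suc (g n). X i = (S(g n := False)) i" and
      redX: "\<And>n. rec_eval (\<lambda>n. of_bool (X n)) p [n] (of_bool (X (g n)))"
      by blast
    have "rec_eval (\<lambda>n. of_bool (X n)) p [n] 0" using redX[of n] X by simp
    from bounded_eval_complete[OF this] obtain u where
      u: "\<And>s g'. u \<le> s \<Longrightarrow> (\<forall>i<u. g' i = of_bool (X i)) \<Longrightarrow> bounded_eval p s g' [n] = Suc 0"
      by blast
    \<comment> \<open>\<open>Y\<close> follows \<open>X\<close> on the use \<open>u\<close> of the
      first computation, except at \<open>g n\<close>. Hence the bits of \<open>Y\<close>, with
      position \<open>g n\<close> overwritten by 0 or 1, serve both computations.\<close>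
    have "\<forall>i<l. (X(g n := True)) i = S i" using that X by auto
    from dense[OF this, of "max u (Suc (g n))"] obtain Y where
      Y: "\<forall>i<max u (Suc (g n)). Y i = (X(g n := True)) i" and
      redY: "\<And>n. rec_eval (\<lambda>n. of_bool (Y n)) p [n] (of_bool (Y (g n)))"
      by blast
    have "rec_eval (\<lambda>n. of_bool (Y n)) p [n] 1" using redY[of n] Y by simp
    from bounded_eval_complete[OF this] obtain w where
      w: "\<And>s g'. w \<le> s \<Longrightarrow> (\<forall>i<w. g' i = of_bool (Y i)) \<Longrightarrow> bounded_eval p s g' [n] = Suc 1"
      by blast
    \<comment> \<open>The size of \<open>t\<close> makes the stage \<open>e \<ge> t\<close>
      sufficient for both computations and keeps \<open>g n - l\<close> at most
      \<open>2 * t\<close>, so that \<open>t\<close> is the root of \<open>e\<close>.\<close>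
    obtain t where t: "u + w + g n \<le> t" "\<forall>i<u + w. bit t i = Y i"
      using nat_with_initial_bits by blast
    define e where "e = t * t + (g n - l)"
    have sqrt: "floor_sqrt e = t"
      unfolding e_def using t(1) by (intro floor_sqrt_unique) (auto simp: power2_eq_square)
    then have pos: "pos e = g n" using that by (simp add: pos_def e_def)
    have "t \<le> e" by (cases t) (auto simp: e_def)
    have "bounded_eval p e (L 0 e) [n] = Suc 0"
      by (rule u) (use \<open>t \<le> e\<close> t X Y that in \<open>auto simp: L_def pos sqrt\<close>)
    moreover have "bounded_eval p e (L 1 e) [n] = Suc 1"
      by (rule w) (use \<open>t \<le> e\<close> t X Y that in \<open>auto simp: L_def pos sqrt\<close>)
    ultimately show ?thesis by (auto simp: T_def)
  qed

  have comp_pos: "computable k (\<lambda>xs. pos (H xs))" if "computable k H" for k H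
    unfolding pos_def using that
    by (intro computable_add computable_diff computable_mult computable_floor_sqrt computable_const)
  \<comment> \<open>\<open>S\<close> may be noncomputable, but only its finitely many bits below
    \<open>l\<close> enter.\<close>
  have table: "computable 1 (\<lambda>xs. of_bool (xs ! 0 < l \<and> S (xs ! 0)))"
    by (rule computable_finite_change[of "{..<l}" "\<lambda>_. 0" "\<lambda>i. of_bool (i < l \<and> S i)"])
      (auto intro: computable_const)
  have comp_L: "computable 2 (\<lambda>xs. L v (xs ! 0) (xs ! 1))" for v
  proof -
    have "computable 2 (\<lambda>xs. if xs ! 1 = pos (xs ! 0) then v else if xs ! 1 < l
        then of_bool (xs ! 1 < l \<and> S (xs ! 1)) else of_bool (bit (floor_sqrt (xs ! 0)) (xs ! 1)))"
      by (intro computable_if_eq computable_if_less computable_const computable_bit computable_floor_sqrt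
          comp_pos computable_compose1[OF table] computable_nth) simp_all
    also have "?this \<longleftrightarrow> ?thesis"
      by (rule computable_cong) (auto simp: L_def)
    finally show ?thesis .
  qed
  have comp_eval: "computable (Suc 1) (\<lambda>xs. bounded_eval p (xs ! 0) (L v (xs ! 0)) [xs ! 1])" for v
  proof -
    note computable_bounded_eval[OF comp_L[of v], of 1 p]
    also have "computable (Suc 1) (\<lambda>xs. bounded_eval p (xs ! 0) (L v (xs ! 0)) (tl xs)) \<longleftrightarrow> ?thesis"
      by (rule computable_cong) (auto simp: length_Suc_conv)
    finally show ?thesis .
  qed
  have comp_F: "computable 1 (\<lambda>xs. of_bool (xs ! 0 \<notin> F))"
    by (rule computable_finite_change[of F "\<lambda>_. 1" "\<lambda>n. of_bool (n \<notin> F)"])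
      (use \<open>finite F\<close> in \<open>auto intro: computable_const\<close>)
  \<comment> \<open>The factor makes the search stop at once on \<open>F\<close>, so it is total;
    the wrong values there are repaired by \<open>computable_finite_change\<close>.\<close>
  let ?T = "\<lambda>xs. of_bool (xs ! 1 \<notin> F) * T (xs ! 0) (xs ! 1)"
  have "computable (Suc 1) ?T"
    unfolding T_def
    by (intro computable_mult computable_if_eq comp_eval computable_const
        computable_compose1[OF comp_F] computable_nth) simp_all
  then have "computable 1 (\<lambda>xs. LEAST e. ?T (e # xs) = 0)"
    by (rule computable_Least) (use T_ex in \<open>force simp: F_def not_less\<close>)
  then have "computable 1 (\<lambda>xs. pos (LEAST e. ?T (e # xs) = 0))"
    by (rule comp_pos)
  then have "computable 1 (\<lambda>xs. (\<lambda>n. pos (LEAST e. of_bool (n \<notin> F) * T e n = 0)) (xs ! 0))"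
    by simp
  then show ?thesis
  proof (rule computable_finite_change[OF \<open>finite F\<close>])
    fix n assume n: "n \<notin> F"
    then have "\<exists>e. T e n = 0" by (intro T_ex) (simp add: F_def)
    then have "T (LEAST e. T e n = 0) n = 0" by (rule LeastI_ex)
    with n show "g n = pos (LEAST e. of_bool (n \<notin> F) * T e n = 0)" by (simp add: T_pos)
  qed
qed

section \<open>From the conjugated successor to \<open>f\<close>\<close>

theorem theorem6p2:
  fixes f :: "nat \<Rightarrow> nat" and \<pi> :: "turing_degree \<Rightarrow> turing_degree"
  assumes "bij f"
    and "\<And>A. \<pi> (deg A) = deg (pullback f A)"
    and "degree_automorphism \<pi>"
  shows "recursive f"
proof -
  define g where "g n = inv f (Suc (f n))" for n
  have inj: "inj g"
    using \<open>bij f\<close> unfolding g_def inj_def by (metis bij_inv_eq_iff nat.inject)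
  have "(\<lambda>n. A (g n)) \<le>\<^sub>T A" for A
  proof -
    define B where "B n = A (inv f n)" for n
    have "(\<lambda>n. B (Suc n)) \<le>\<^sub>T B"
      unfolding turing_le_def recursive_in_def
    proof (intro exI[of _ "Comp Oracle [Succ]"] allI)
      show "rec_eval (\<lambda>n. of_bool (B n)) (Comp Oracle [Succ]) [n] (of_bool (B (Suc n)))" for n
        by (rule rec_eval_Comp[where ys = "[Suc n]"]) (simp add: rec_eval_Succ, rule rec_eval_Oracle)
    qed
    then have "deg (\<lambda>n. B (Suc n)) \<le> deg B"
      by (simp add: less_eq_turing_degree.abs_eq)
    then have "deg (pullback f (\<lambda>n. B (Suc n))) \<le> deg (pullback f B)"
      using assms(2,3) unfolding degree_automorphism_def by metis
    moreover have "pullback f B = A"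
      using \<open>bij f\<close> by (simp add: pullback_def B_def bij_is_inj)
    moreover have "pullback f (\<lambda>n. B (Suc n)) = (\<lambda>n. A (g n))"
      by (simp add: pullback_def B_def g_def)
    ultimately show ?thesis
      by (simp add: less_eq_turing_degree.abs_eq)
  qed
  with inj have g: "computable 1 (\<lambda>xs. g (xs ! 0))"
    by (rule computable_if_pullback_below)
  have iter: "rec_nat (inv f 0) (\<lambda>n r. g r) m = inv f m" for m
    using \<open>bij f\<close> by (induction m) (auto simp: g_def bij_is_surj surj_f_inv_f)
  have inv: "computable k (\<lambda>xs. inv f (H xs))" if "computable k H" for k H
  proof -
    have "computable (Suc (Suc k)) (\<lambda>ys. g (ys ! 1))"
      by (intro computable_compose1[OF g] computable_nth) simp
    from computable_rec_nat[OF computable_const this that, of "inv f 0"]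
    show ?thesis by (simp add: iter)
  qed
  \<comment> \<open>Once \<open>inv f\<close> is computable, \<open>f n\<close> is found by
    searching for its unique preimage under \<open>inv f\<close>; the candidate is argument 0 and
    \<open>n\<close> is argument 1.\<close>
  let ?D = "\<lambda>xs. if inv f (xs ! 0) = xs ! 1 then 0 else 1 :: nat"
  have D: "(?D (y # xs) = 0) \<longleftrightarrow> f (xs ! 0) = y" for y and xs :: "nat list"
    using \<open>bij f\<close> by (auto simp: bij_is_inj bij_is_surj surj_f_inv_f inv_f_eq dest: sym)
  have "computable (Suc 1) ?D"
    by (intro computable_if_eq inv computable_const computable_nth) simp_all
  then have "computable 1 (\<lambda>xs. LEAST y. ?D (y # xs) = 0)"
    by (rule computable_Least) (simp only: D, blast)
  then have "computable 1 (\<lambda>xs. f (xs ! 0))"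
    unfolding D by (simp add: Least_equality)
  then show ?thesis by (rule recursive_if_computable)
qed

end
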